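(* Let $W\times T\subset\mathbb{R}^2\times\mathbb{R}$ be a bounded non-empty open set and assume: (i) $\{Y_i\}_{i\ge1}$ and $\{E_i\}_{i\ge1}$ are two independent sequences of independent and identically distributed point processes on $W\times T$, defined on the same underlying probability space; $X_n=\bigcup_{i=1}^nY_i$ and $D_n=\bigcup_{i=1}^nE_i$. (ii) Each $Y_i$ is a point process (not necessarily Poisson) with intensity function $\lambda(u;\boldsymbol\theta)=b(u)\exp(\boldsymbol\theta^\top\boldsymbol z(u))$, where $b:W\times T\to(0,\infty)$ is absolutely integrable, $\boldsymbol z=[z^{(1)},\dots,z^{(m)}]^\top:W\times T\to\mathbb{R}^m$ is measurable, and $\boldsymbol\theta$ lies in an open set $\boldsymbol\Theta\subset\mathbb{R}^m$; each $E_i$ has an absolutely integrable intensity function $\rho(u)>0$. (iii) For every $\boldsymbol\theta\in\boldsymbol\Theta$ there exist $\epsilon_1(\boldsymbol\theta),\epsilon_2(\boldsymbol\theta)>0$ with $\epsilon_1(\boldsymbol\theta)<\inf_{u\in W\times T}\rho(u)/\lambda(u;\boldsymbol\theta)$ and $\sup_{u\in W\times T}\rho(u)/\lambda(u;\boldsymbol\theta)<\epsilon_2(\boldsymbol\theta)$. (iv) $\sup_{u\in W\times T}\|\boldsymbol z(u)\|<\infty$. (v) $\boldsymbol\Theta$ is convex. (vi) For $\boldsymbol\theta,\tilde{\boldsymbol\theta}\in\boldsymbol\Theta$, if $\lambda(u;\boldsymbol\theta)=\lambda(u;\tilde{\boldsymbol\theta})$ for almost every $u\in W\times T$, then $\boldsymbol\theta=\tilde{\boldsymbol\theta}$.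 Let $\boldsymbol\theta_0\in\boldsymbol\Theta$ be the true parameter value, and for $\boldsymbol\theta\in\boldsymbol\Theta$ define $$l_n(\boldsymbol\theta)=\sum_{x\in X_n}\log\left[\frac{\lambda(x;\boldsymbol\theta)}{\lambda(x;\boldsymbol\theta)+\rho(x)}\right]+\sum_{x\in D_n}\log\left[\frac{\rho(x)}{\lambda(x;\boldsymbol\theta)+\rho(x)}\right].$$ Set $\widehat{\boldsymbol\theta}_n=\arg\max_{\boldsymbol\theta\in\boldsymbol\Theta}l_n(\boldsymbol\theta)$. If $\widehat{\boldsymbol\theta}_n$ is attained (that is, the maximum is achieved at a point of $\boldsymbol\Theta$), then, as $n\to\infty$, $\widehat{\boldsymbol\theta}_n$ converges $P_{\boldsymbol\theta_0}$-almost surely to $\boldsymbol\theta_0$.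
   Context: A point process $Z$ on $W\times T$ has intensity function $\kappa:W\times T\to[0,\infty)$ if $\mathbb{E}\{\sum_{x\in Z}1(x\in B)\}=\int_B\kappa(u)\,du$ for every Borel set $B\subset W\times T$. Unions of point processes are superpositions, so $\sum_{x\in X_n}=\sum_{i=1}^n\sum_{x\in Y_i}$ and likewise for $D_n$. $P_{\boldsymbol\theta_0}$ denotes the probability distribution under the true parameter value $\boldsymbol\theta_0$, i.e. when each $Y_i$ has intensity function $\lambda(\cdot;\boldsymbol\theta_0)$; the law of the $E_i$ does not depend on $\boldsymbol\theta$. *)

theory Defs
  imports "HOL-Probability.Probability" "HOL-Library.Multiset"
begin

section \<open>Point processes\<close>

text \<open>
  A locally finite configuration has finitely many points in every bounded set, so on a bounded
  set \<open>S\<close> the configurations are exactly the finite multisets of points of \<open>S\<close>. Repeated points are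
  allowed, and the superposition of point processes is the sum of multisets. The sigma-algebra is
  the usual one, generated by the counts of points in Borel sets.
\<close>

definition config_space :: "'a::topological_space set \<Rightarrow> 'a multiset measure" where
  "config_space S =
     sigma {X. set_mset X \<subseteq> S}
           {{X. set_mset X \<subseteq> S \<and> size {#x \<in># X. x \<in> B#} = k} | B k. B \<in> sets borel \<and> B \<subseteq> S}"

definition point_process ::
    "'w measure \<Rightarrow> 'a::topological_space set \<Rightarrow> ('w \<Rightarrow> 'a multiset) \<Rightarrow> bool" where
  "point_process M S Z \<longleftrightarrow> Z \<in> measurable M (config_space S)"

lemma point_process_iff:
  "point_process M S Z \<longleftrightarrow>
     (\<forall>w\<in>space M. set_mset (Z w) \<subseteq> S) \<and>
     (\<forall>B\<in>sets borel. B \<subseteq> S \<longrightarrow>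
        (\<lambda>w. size {#x \<in># Z w. x \<in> B#}) \<in> measurable M (count_space UNIV))"
  (is "?L \<longleftrightarrow> ?R")
proof
  assume L: ?L
  have sp: "\<forall>w\<in>space M. set_mset (Z w) \<subseteq> S"
    using measurable_space[OF L[unfolded point_process_def]]
    by (auto simp: config_space_def space_measure_of_conv)
  have "(\<lambda>w. size {#x \<in># Z w. x \<in> B#}) \<in> measurable M (count_space UNIV)"
    if B: "B \<in> sets borel" "B \<subseteq> S" for B
  proof (subst measurable_count_space_eq2_countable, safe)
    fix k :: nat
    let ?A = "{X. set_mset X \<subseteq> S \<and> size {#x \<in># X. x \<in> B#} = k}"
    have "?A \<in> sets (config_space S)"
      unfolding config_space_def using B by (intro in_measure_of) auto
    from measurable_sets[OF L[unfolded point_process_def] this]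
    have "Z -` ?A \<inter> space M \<in> sets M" .
    also have "Z -` ?A \<inter> space M = (\<lambda>w. size {#x \<in># Z w. x \<in> B#}) -` {k} \<inter> space M"
      using sp by auto
    finally show "(\<lambda>w. size {#x \<in># Z w. x \<in> B#}) -` {k} \<inter> space M \<in> sets M" .
  qed auto
  with sp show ?R by blast
next
  assume R: ?R
  show ?L
    unfolding point_process_def config_space_def
  proof (rule measurable_measure_of)
    fix A
    assume "A \<in> {{X. set_mset X \<subseteq> S \<and> size {#x \<in># X. x \<in> B#} = k} | B k.
                  B \<in> sets borel \<and> B \<subseteq> S}"
    then obtain B k where B: "B \<in> sets borel" "B \<subseteq> S"
      and A: "A = {X. set_mset X \<subseteq> S \<and> size {#x \<in># X. x \<in> B#} = k}" by blast
    have "(\<lambda>w. size {#x \<in># Z w. x \<in> B#}) -` {k} \<inter> space M \<in> sets M"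
      using R B by (intro measurable_sets[of _ _ "count_space UNIV"]) auto
    also have "(\<lambda>w. size {#x \<in># Z w. x \<in> B#}) -` {k} \<inter> space M = Z -` A \<inter> space M"
      using R by (auto simp: A)
    finally show "Z -` A \<inter> space M \<in> sets M" .
  qed (use R in auto)
qed

definition has_intensity ::
    "'w measure \<Rightarrow> 'a::euclidean_space set \<Rightarrow> ('w \<Rightarrow> 'a multiset) \<Rightarrow> ('a \<Rightarrow> real) \<Rightarrow> bool" where
  "has_intensity M S Z \<kappa> \<longleftrightarrow>
     set_borel_measurable borel S \<kappa> \<and> (\<forall>u\<in>S. 0 \<le> \<kappa> u) \<and>
     (\<forall>B\<in>sets borel. B \<subseteq> S \<longrightarrow>
        (\<integral>\<^sup>+w. (\<Sum>x\<in>#Z w. indicator B x) \<partial>M) = (\<integral>\<^sup>+u\<in>B. ennreal (\<kappa> u) \<partial>lborel))"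

definition iid_point_processes ::
    "'w measure \<Rightarrow> 'a::topological_space set \<Rightarrow> (nat \<Rightarrow> 'w \<Rightarrow> 'a multiset) \<Rightarrow> bool" where
  "iid_point_processes M S Z \<longleftrightarrow>
     (\<forall>i. point_process M S (Z i)) \<and>
     prob_space.indep_vars M (\<lambda>_. config_space S) Z UNIV \<and>
     (\<forall>i j. distr M (config_space S) (Z i) = distr M (config_space S) (Z j))"

text \<open>Independence of two sequences, each taken as a single random element of a product space.\<close>

definition indep_sequences ::
    "'w measure \<Rightarrow> 'a::topological_space set \<Rightarrow>
     (nat \<Rightarrow> 'w \<Rightarrow> 'a multiset) \<Rightarrow> (nat \<Rightarrow> 'w \<Rightarrow> 'a multiset) \<Rightarrow> bool" where
  "indep_sequences M S Y E \<longleftrightarrow>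
     prob_space.indep_var M
       (\<Pi>\<^sub>M i\<in>UNIV. config_space S) (\<lambda>w i. Y i w)
       (\<Pi>\<^sub>M i\<in>UNIV. config_space S) (\<lambda>w i. E i w)"

definition superpose :: "(nat \<Rightarrow> 'w \<Rightarrow> 'a multiset) \<Rightarrow> nat \<Rightarrow> 'w \<Rightarrow> 'a multiset" where
  "superpose Z n w = (\<Sum>i<n. Z i w)"

section \<open>The log-linear model and its logistic log-likelihood\<close>

definition loglinear :: "('a \<Rightarrow> real) \<Rightarrow> ('a \<Rightarrow> real^'m) \<Rightarrow> real^'m \<Rightarrow> 'a \<Rightarrow> real" where
  "loglinear b z \<theta> u = b u * exp (\<theta> \<bullet> z u)"

definition logistic_loglik ::
    "('p \<Rightarrow> 'a \<Rightarrow> real) \<Rightarrow> ('a \<Rightarrow> real) \<Rightarrow> 'a multiset \<Rightarrow> 'a multiset \<Rightarrow> 'p \<Rightarrow> real" where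
  "logistic_loglik lam \<rho> X D \<theta> =
     (\<Sum>x\<in>#X. ln (lam \<theta> x / (lam \<theta> x + \<rho> x))) + (\<Sum>x\<in>#D. ln (\<rho> x / (lam \<theta> x + \<rho> x)))"

end

theory Submission
  imports Defs
begin

text \<open>
  In the model with parameter \<open>\<theta>\<close>, data points and dummy points occur at \<open>u\<close> in the proportion
  \<open>\<lambda>(u;\<theta>)\<close> to \<open>\<rho>(u)\<close>, and \<open>-l\<^sub>n\<close> is the logistic loss for telling them apart. With
  \<open>softplus t = ln (1 + exp t)\<close>, every point contributes softplus of an affine function of \<open>\<theta>\<close> to
  \<open>-l\<^sub>n\<close>, so \<open>-l\<^sub>n\<close> is convex on the whole parameter space, and it is Lipschitz with a constant
  proportional to the number of points, because softplus is 1-Lipschitz and \<open>z\<close> is bounded. The proof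
  rests on three facts.

  \<^item> Pointwise limit. \<open>-l\<^sub>n(\<theta>)/n\<close> is the sum of two averages of independent and identically distributed
  random sums. By the strong law of large numbers and Campbell's formula it converges almost surely
  to the risk \<open>R(\<theta>)\<close>, the integral of the two losses against \<open>\<lambda>(u;\<theta>\<^sub>0)\<close> and \<open>\<rho>(u)\<close>. The bounds
  on \<open>\<rho>/\<lambda>\<close> make the integrands integrable. The numbers of points per sample are only known to have a
  first moment, so the strong law is needed in its full form; it is proved here by a maximal
  inequality and Kolmogorov's zero-one law (\<open>strong_law_of_large_numbers\<close>).

  \<^item> Identification. Gibbs' inequality at each \<open>u\<close>, together with the identifiability of the
  intensities, gives \<open>R(\<theta>\<^sub>0) < R(\<theta>)\<close> for all other \<open>\<theta>\<close> in \<open>\<Theta>\<close> (\<open>risk_less\<close>).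

  \<^item> Localisation. On a small sphere around \<open>\<theta>\<^sub>0\<close>, a finite net and the Lipschitz bound turn the limits
  at finitely many points into \<open>l\<^sub>n(\<theta>) < l\<^sub>n(\<theta>\<^sub>0)\<close> on the whole sphere for all large \<open>n\<close>
  (\<open>loss_separated_on_sphere\<close>). Convexity then forces every maximiser of \<open>l\<^sub>n\<close> into the open ball
  (\<open>convex_argmin_in_ball\<close>).
\<close>

section \<open>The strong law of large numbers\<close>

text \<open>
  The maximum of \<open>0\<close> and the first \<open>n\<close> partial sums of \<open>v\<close>. It is defined by Lindley's recursion, which
  splits off the first term instead of the last: the maximal inequality below compares a sequence
  with its shift.
\<close>

primrec running_max :: "nat \<Rightarrow> (nat \<Rightarrow> real) \<Rightarrow> real" where
  "running_max 0 v = 0"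
| "running_max (Suc n) v = max 0 (v 0 + running_max n (\<lambda>i. v (Suc i)))"

lemma running_max_nonneg: "0 \<le> running_max n v"
  by (cases n) auto

lemma running_max_mono: "running_max n v \<le> running_max (Suc n) v"
proof (induction n arbitrary: v)
  case (Suc n)
  show ?case using Suc[of "\<lambda>i. v (Suc i)"] by auto
qed simp

lemma partial_sum_le_running_max: "(\<Sum>i<n. v i) \<le> running_max n v"
proof (induction n arbitrary: v)
  case (Suc n)
  show ?case using Suc[of "\<lambda>i. v (Suc i)"]
    by (simp add: sum.lessThan_Suc_shift del: sum.lessThan_Suc)
qed simp

lemma running_max_le_sum_abs: "running_max n v \<le> (\<Sum>i<n. \<bar>v i\<bar>)"
proof (induction n arbitrary: v)
  case (Suc n)
  have "0 \<le> (\<Sum>i<n. \<bar>v (Suc i)\<bar>)" by (simp add: sum_nonneg)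
  then show ?case using Suc[of "\<lambda>i. v (Suc i)"]
    by (simp add: sum.lessThan_Suc_shift del: sum.lessThan_Suc)
qed simp

lemma running_max_measurable [measurable]:
  "running_max n \<in> borel_measurable (\<Pi>\<^sub>M i\<in>UNIV. borel)"
proof (induction n)
  case (Suc n)
  have shift: "(\<lambda>v i. v (Suc i)) \<in> (\<Pi>\<^sub>M i\<in>UNIV. borel) \<rightarrow>\<^sub>M (\<Pi>\<^sub>M i\<in>UNIV. (borel :: real measure))"
    by (rule measurable_PiM_single') (auto simp: space_PiM)
  note measurable_compose[OF shift Suc, measurable]
  show ?case by simp
qed simp

lemma bdd_above_partial_sums_shift:
  fixes v :: "nat \<Rightarrow> real"
  shows "bdd_above (range (\<lambda>n. \<Sum>i<n. v (i + m))) \<longleftrightarrow> bdd_above (range (\<lambda>n. \<Sum>i<n. v i))"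
proof (induction m)
  case (Suc m)
  have *: "bdd_above (range (\<lambda>n. \<Sum>i<n. u (Suc i))) \<longleftrightarrow> bdd_above (range (\<lambda>n. \<Sum>i<n. u i))"
    for u :: "nat \<Rightarrow> real"
  proof
    assume "bdd_above (range (\<lambda>n. \<Sum>i<n. u (Suc i)))"
    then obtain B where B: "(\<Sum>i<n. u (Suc i)) \<le> B" for n
      by (auto simp: bdd_above_def)
    have "(\<Sum>i<n. u i) \<le> max 0 (u 0 + B)" for n
      using B by (cases n) (auto simp: sum.lessThan_Suc_shift le_max_iff_disj simp del: sum.lessThan_Suc)
    then show "bdd_above (range (\<lambda>n. \<Sum>i<n. u i))" by (rule bdd_aboveI2)
  next
    assume "bdd_above (range (\<lambda>n. \<Sum>i<n. u i))"
    then obtain B where B: "(\<Sum>i<n. u i) \<le> B" for n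
      by (auto simp: bdd_above_def)
    have "(\<Sum>i<n. u (Suc i)) \<le> B - u 0" for n
      using B[of "Suc n"] by (simp add: sum.lessThan_Suc_shift del: sum.lessThan_Suc)
    then show "bdd_above (range (\<lambda>n. \<Sum>i<n. u (Suc i)))" by (rule bdd_aboveI2)
  qed
  show ?case using *[of "\<lambda>i. v (i + m)"] Suc by simp
qed simp

context prob_space
begin

text \<open>
  Deleting the first \<open>m\<close> terms changes all later partial sums by the same amount. Hence unboundedness
  of the partial sums is a tail event, and Kolmogorov's zero-one law applies.
\<close>

lemma unbounded_partial_sums_0_1:
  fixes X :: "nat \<Rightarrow> 'a \<Rightarrow> real"
  assumes indep: "indep_vars (\<lambda>_. borel) X UNIV"
  defines "U \<equiv> {w \<in> space M. \<not> bdd_above (range (\<lambda>n. \<Sum>i<n. X i w))}"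
  shows "U \<in> events" "prob U = 0 \<or> prob U = 1"
proof -
  define A where "A = (\<lambda>i. {X i -` B \<inter> space M | B. B \<in> sets borel})"
  have X: "random_variable borel (X i)" for i
    using indep by (auto simp: indep_vars_def2)
  have A: "sigma_algebra (space M) (A i)" for i
    using sets.sigma_algebra_axioms[of "vimage_algebra (space M) (X i) borel"]
    by (simp add: sets_vimage_algebra2 A_def)
  have indepA: "indep_sets A UNIV"
    using indep by (simp add: indep_vars_def2 A_def)
  have tail: "U \<in> tail_events A"
    unfolding tail_events_def
  proof safe
    fix m
    let ?N = "sigma (space M) (\<Union> (A ` {m..}))"
    have sub: "\<Union> (A ` {m..}) \<subseteq> Pow (space M)" by (auto simp: A_def)
    have [measurable]: "X (i + m) \<in> borel_measurable ?N" for i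
    proof (rule measurableI)
      fix B :: "real set" assume "B \<in> sets borel"
      then have "X (i + m) -` B \<inter> space M \<in> \<Union> (A ` {m..})"
        by (auto simp: A_def intro!: bexI[of _ "i + m"])
      then show "X (i + m) -` B \<inter> space ?N \<in> sets ?N"
        using sub by (simp add: space_measure_of sets_measure_of sigma_sets.Basic)
    qed simp
    have bdd: "bdd_above (range f) \<longleftrightarrow> (\<exists>k::nat. \<forall>n. f n \<le> real k)" for f :: "nat \<Rightarrow> real"
    proof
      assume "bdd_above (range f)"
      then obtain B where "f n \<le> B" for n by (auto simp: bdd_above_def)
      then show "\<exists>k::nat. \<forall>n. f n \<le> real k"
        by (meson real_arch_simple order_trans)
    qed (auto simp: bdd_above_def)
    have "U = {w \<in> space ?N. \<not> (\<exists>k::nat. \<forall>n. (\<Sum>i<n. X (i + m) w) \<le> real k)}"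
      unfolding U_def using sub
      by (simp add: space_measure_of bdd_above_partial_sums_shift[of "\<lambda>i. X i _" m, symmetric] bdd)
    also have "\<dots> \<in> sets ?N" by measurable
    finally show "U \<in> sigma_sets (space M) (\<Union> (A ` {m..}))"
      using sub by (simp add: sets_measure_of)
  qed
  show "prob U = 0 \<or> prob U = 1"
    by (rule kolmogorov_0_1_law[OF A indepA tail])
  have "A i \<subseteq> events" for i using X by (auto simp: A_def)
  then show "U \<in> events" using tail_events_sets tail by blast
qed

lemma iid_distr_shift:
  fixes X :: "nat \<Rightarrow> 'a \<Rightarrow> 'b"
  assumes indep: "indep_vars (\<lambda>_. N) X UNIV"
    and ident: "\<And>i. distr M N (X i) = distr M N (X 0)"
  shows "distr M (\<Pi>\<^sub>M i\<in>UNIV. N) (\<lambda>w i. X (Suc i) w) = distr M (\<Pi>\<^sub>M i\<in>UNIV. N) (\<lambda>w i. X i w)"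
proof -
  let ?P = "\<Pi>\<^sub>M i\<in>(UNIV :: nat set). N"
  let ?D = "\<Pi>\<^sub>M i\<in>(UNIV :: nat set). distr M N (X 0)"
  have X [measurable]: "random_variable N (X i)" for i
    using indep by (auto simp: indep_vars_def2)
  have seq: "(\<lambda>w i. X i w) \<in> M \<rightarrow>\<^sub>M ?P"
    by (rule measurable_PiM_single') (auto intro: measurable_space[OF X])
  have shift: "(\<lambda>v i. v (Suc i)) \<in> ?P \<rightarrow>\<^sub>M ?P"
    by (rule measurable_PiM_single') (auto simp: space_PiM)
  have "distr M ?P (\<lambda>w i. X i w) = (\<Pi>\<^sub>M i\<in>UNIV. distr M N (X i))"
    using indep_vars_iff_distr_eq_PiM[of UNIV X "\<lambda>_. N"] indep X by (simp add: restrict_UNIV)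
  also have "\<dots> = ?D"
    by (rule PiM_cong) (auto intro: ident)
  finally have D: "distr M ?P (\<lambda>w i. X i w) = ?D" .
  have "distr M ?P (\<lambda>w i. X (Suc i) w) = distr (distr M ?P (\<lambda>w i. X i w)) ?P (\<lambda>v i. v (Suc i))"
    using seq shift by (simp add: distr_distr comp_def)
  also have "\<dots> = distr ?D ?D (\<lambda>v. \<lambda>i\<in>UNIV. v (Suc i))"
    unfolding D by (rule distr_cong) (auto simp: restrict_UNIV intro!: sets_PiM_cong)
  also have "\<dots> = ?D"
    by (rule distr_PiM_reindex) (auto intro!: prob_space_distr)
  finally show ?thesis by (simp add: D)
qed

text \<open>
  Let \<open>R n\<close> be the running maximum of \<open>X 0, X 1, \<dots>\<close> and \<open>V n\<close> that of the shifted sequence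
  \<open>X 1, X 2, \<dots>\<close>. Lindley's recursion reads \<open>R (n + 1) - V n = max (X 0) (- V n)\<close>. Since \<open>V n\<close> has the
  distribution of \<open>R n\<close>, which is at most \<open>R (n + 1)\<close>, the right hand side has nonnegative expectation.
  If the partial sums were almost surely unbounded above, then \<open>V n\<close> would tend to infinity and
  dominated convergence would give \<open>expectation (X 0) \<ge> 0\<close>. By the zero-one law, the only alternative
  is that they are almost surely bounded above.
\<close>

lemma iid_negative_drift_bdd_above:
  fixes X :: "nat \<Rightarrow> 'a \<Rightarrow> real"
  assumes indep: "indep_vars (\<lambda>_. borel) X UNIV"
    and ident: "\<And>i. distr M borel (X i) = distr M borel (X 0)"
    and int: "integrable M (X 0)" and neg: "expectation (X 0) < 0"
  shows "AE w in M. bdd_above (range (\<lambda>n. \<Sum>i<n. X i w))"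
proof -
  let ?P = "\<Pi>\<^sub>M i\<in>(UNIV :: nat set). (borel :: real measure)"
  define U where "U = {w \<in> space M. \<not> bdd_above (range (\<lambda>n. \<Sum>i<n. X i w))}"
  define V where "V = (\<lambda>n w. running_max n (\<lambda>i. X (Suc i) w))"
  have [measurable]: "random_variable borel (X i)" for i
    using indep by (auto simp: indep_vars_def2)
  have intX: "integrable M (X i)" for i
  proof -
    have "integrable (distr M borel (X i)) (\<lambda>x. x)"
      unfolding ident[of i] using int by (subst integrable_distr_eq) auto
    then show ?thesis by (subst (asm) integrable_distr_eq) auto
  qed
  have seq [measurable]: "(\<lambda>w i. X (g i) w) \<in> M \<rightarrow>\<^sub>M ?P" for g
    by (rule measurable_PiM_single') auto
  have int_rm: "integrable M (\<lambda>w. running_max n (\<lambda>i. X (g i) w))" for n g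
  proof (rule Bochner_Integration.integrable_bound)
    show "integrable M (\<lambda>w. \<Sum>i<n. \<bar>X (g i) w\<bar>)"
      using intX by auto
    show "AE w in M. norm (running_max n (\<lambda>i. X (g i) w)) \<le> norm (\<Sum>i<n. \<bar>X (g i) w\<bar>)"
      using running_max_nonneg running_max_le_sum_abs
      by (intro AE_I2) (simp add: sum_nonneg)
  qed simp
  have shift: "expectation (V n) = expectation (\<lambda>w. running_max n (\<lambda>i. X i w))" for n
  proof -
    have "expectation (\<lambda>w. running_max n (\<lambda>i. X (g i) w))
        = integral\<^sup>L (distr M ?P (\<lambda>w i. X (g i) w)) (running_max n)" for g
      by (subst integral_distr) auto
    then show ?thesis
      unfolding V_def by (simp add: iid_distr_shift[OF indep ident])
  qed
  \<comment> \<open>The maximal inequality.\<close>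
  have nonneg: "0 \<le> expectation (\<lambda>w. max (X 0 w) (- V n w))" for n
  proof -
    have "(\<lambda>w. max (X 0 w) (- V n w)) = (\<lambda>w. running_max (Suc n) (\<lambda>i. X i w) - V n w)"
      by (auto simp: V_def fun_eq_iff)
    then have "expectation (\<lambda>w. max (X 0 w) (- V n w))
      = expectation (\<lambda>w. running_max (Suc n) (\<lambda>i. X i w)) - expectation (V n)"
      using int_rm[of "Suc n" "\<lambda>i. i"] int_rm[of n Suc]
      by (simp add: V_def)
    moreover have "expectation (\<lambda>w. running_max n (\<lambda>i. X i w))
        \<le> expectation (\<lambda>w. running_max (Suc n) (\<lambda>i. X i w))"
      using int_rm[of _ "\<lambda>i. i"] by (intro integral_mono running_max_mono)
    ultimately show ?thesis unfolding shift by simp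
  qed
  have "prob U \<noteq> 1"
  proof
    assume "prob U = 1"
    then have "AE w in M. w \<in> U"
      using AE_prob_1 by blast
    then have "AE w in M. (\<lambda>n. max (X 0 w) (- V n w)) \<longlonglongrightarrow> X 0 w"
    proof eventually_elim
      case (elim w)
      have "\<not> bdd_above (range (\<lambda>n. \<Sum>i<n. X (Suc i) w))"
        using elim bdd_above_partial_sums_shift[of "\<lambda>i. X i w" 1] by (simp add: U_def)
      then obtain n where n: "- X 0 w < (\<Sum>i<n. X (Suc i) w)"
        by (metis bdd_aboveI2 not_less)
      \<comment> \<open>Once \<open>V\<close> has exceeded \<open>- X 0\<close> it stays above it, so the convergence is eventual equality.\<close>
      have "max (X 0 w) (- V k w) = X 0 w" if "n \<le> k" for k
      proof -
        have "V n w \<le> V k w"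
          unfolding V_def using that by (rule lift_Suc_mono_le[of "\<lambda>n. running_max n _", OF running_max_mono])
        then show ?thesis
          using n partial_sum_le_running_max[of "\<lambda>i. X (Suc i) w" n] by (simp add: V_def)
      qed
      then show ?case
        by (intro tendsto_eventually) (auto simp: eventually_sequentially)
    qed
    then have "(\<lambda>n. expectation (\<lambda>w. max (X 0 w) (- V n w))) \<longlonglongrightarrow> expectation (X 0)"
    proof (rule integral_dominated_convergence[where w = "\<lambda>w. \<bar>X 0 w\<bar>", rotated 3])
      fix n
      show "AE w in M. norm (max (X 0 w) (- V n w)) \<le> \<bar>X 0 w\<bar>"
        using running_max_nonneg by (intro AE_I2) (auto simp: V_def max_def abs_if not_le; smt (verit) running_max_nonneg)
    qed (use int in \<open>auto simp: V_def\<close>)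
    then have "0 \<le> expectation (X 0)"
      by (rule LIMSEQ_le_const) (use nonneg in auto)
    with neg show False by simp
  qed
  then have "prob U = 0" "U \<in> events"
    using unbounded_partial_sums_0_1[OF indep] by (auto simp: U_def)
  then have "AE w in M. w \<notin> U"
    by (simp add: AE_iff_measurable[of U] emeasure_eq_measure U_def)
  then show ?thesis
    by (rule AE_mp) (auto simp: U_def)
qed

text \<open>
  If \<open>d\<close> lies strictly between the mean and \<open>c\<close>, then \<open>X i - d\<close> has negative drift. So the partial
  sums of \<open>X\<close> exceed \<open>n * d\<close> by a bounded amount only, and this is eventually less than \<open>n * (c - d)\<close>.
\<close>

lemma iid_average_eventually_less:
  fixes X :: "nat \<Rightarrow> 'a \<Rightarrow> real"
  assumes indep: "indep_vars (\<lambda>_. borel) X UNIV"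
    and ident: "\<And>i. distr M borel (X i) = distr M borel (X 0)"
    and int: "integrable M (X 0)" and less: "expectation (X 0) < c"
  shows "AE w in M. \<forall>\<^sub>F n in sequentially. (\<Sum>i<n. X i w) / n < c"
proof -
  obtain d where d: "expectation (X 0) < d" "d < c" using less dense by blast
  have [measurable]: "random_variable borel (X i)" for i
    using indep by (auto simp: indep_vars_def2)
  define Z where "Z = (\<lambda>i w. X i w - d)"
  have "AE w in M. bdd_above (range (\<lambda>n. \<Sum>i<n. Z i w))"
  proof (rule iid_negative_drift_bdd_above)
    show "indep_vars (\<lambda>_. borel) Z UNIV"
      unfolding Z_def by (rule indep_vars_compose2[OF indep]) auto
    have "distr M borel (Z i) = distr (distr M borel (X i)) borel (\<lambda>x. x - d)" for i
      by (subst distr_distr) (auto simp: Z_def comp_def)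
    then show "distr M borel (Z i) = distr M borel (Z 0)" for i
      using ident by metis
    show "integrable M (Z 0)" "expectation (Z 0) < 0"
      using int d by (auto simp: Z_def prob_space)
  qed
  then show ?thesis
  proof eventually_elim
    case (elim w)
    then obtain B where B: "(\<Sum>i<n. Z i w) \<le> B" for n
      by (auto simp: bdd_above_def)
    have "\<forall>\<^sub>F n in sequentially. B / (c - d) < real n"
      by (rule filterlim_real_sequentially[unfolded filterlim_at_top_dense, rule_format])
    then show ?case using eventually_gt_at_top[of 0]
    proof eventually_elim
      case (elim n)
      have "(\<Sum>i<n. X i w) \<le> B + n * d"
        using B[of n] by (simp add: Z_def sum_subtractf)
      also have "\<dots> < n * c"
        using elim d by (simp add: field_simps)
      finally show ?case
        using elim by (simp add: field_simps)
    qed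
  qed
qed

text \<open>
  Both one-sided bounds are instances of the previous lemma, for \<open>X\<close> and for \<open>- X\<close>.
\<close>

theorem strong_law_of_large_numbers:
  fixes X :: "nat \<Rightarrow> 'a \<Rightarrow> real"
  assumes indep: "indep_vars (\<lambda>_. borel) X UNIV"
    and ident: "\<And>i. distr M borel (X i) = distr M borel (X 0)"
    and int: "integrable M (X 0)"
  shows "AE w in M. (\<lambda>n. (\<Sum>i<n. X i w) / n) \<longlonglongrightarrow> expectation (X 0)"
proof -
  let ?\<mu> = "expectation (X 0)"
  have [measurable]: "random_variable borel (X i)" for i
    using indep by (auto simp: indep_vars_def2)
  define Z where "Z = (\<lambda>i w. - X i w)"
  have Z: "indep_vars (\<lambda>_. borel) Z UNIV"
    unfolding Z_def by (rule indep_vars_compose2[OF indep]) auto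
  have "distr M borel (Z i) = distr (distr M borel (X i)) borel uminus" for i
    by (subst distr_distr) (auto simp: Z_def comp_def)
  then have Z': "distr M borel (Z i) = distr M borel (Z 0)" for i
    using ident by metis
  have Z'': "integrable M (Z 0)" "expectation (Z 0) = - ?\<mu>"
    using int by (auto simp: Z_def)
  have "AE w in M. \<forall>\<^sub>F n in sequentially.
      \<bar>(\<Sum>i<n. X i w) / n - ?\<mu>\<bar> < 1 / real (Suc k)" for k
  proof -
    have "AE w in M. \<forall>\<^sub>F n in sequentially. (\<Sum>i<n. X i w) / n < ?\<mu> + 1 / real (Suc k)"
      by (rule iid_average_eventually_less[OF indep ident int]) simp
    moreover have "AE w in M. \<forall>\<^sub>F n in sequentially. (\<Sum>i<n. Z i w) / n < - ?\<mu> + 1 / real (Suc k)"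
      by (rule iid_average_eventually_less[OF Z Z' Z''(1)]) (simp add: Z'')
    ultimately show ?thesis
    proof eventually_elim
      case (elim w)
      from elim(1) elim(2) show ?case
        by eventually_elim (auto simp: Z_def sum_negf abs_less_iff)
    qed
  qed
  then have "AE w in M. \<forall>k. \<forall>\<^sub>F n in sequentially.
      \<bar>(\<Sum>i<n. X i w) / n - ?\<mu>\<bar> < 1 / real (Suc k)"
    by (simp add: AE_all_countable)
  then show ?thesis
  proof eventually_elim
    case (elim w)
    show ?case
    proof (rule tendstoI)
      fix e :: real assume "0 < e"
      then obtain k where k: "1 / real (Suc k) < e" using nat_approx_posE by blast
      show "\<forall>\<^sub>F n in sequentially. dist ((\<Sum>i<n. X i w) / n) ?\<mu> < e"
        using elim[rule_format, of k] by eventually_elim (use k in \<open>simp add: dist_real_def\<close>)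
    qed
  qed
qed

end

section \<open>Sums over the points of a point process\<close>

lemma sum_mset_SUP:
  fixes U :: "nat \<Rightarrow> 'a \<Rightarrow> ennreal"
  assumes "incseq U"
  shows "(\<Sum>x\<in>#X. SUP i. U i x) = (SUP i. \<Sum>x\<in>#X. U i x)"
    and "incseq (\<lambda>i. \<Sum>x\<in>#X. U i x)"
proof -
  have inc: "incseq (\<lambda>i. U i x)" for x
    using assms by (simp add: incseq_def le_fun_def)
  show *: "incseq (\<lambda>i. \<Sum>x\<in>#X. U i x)" for X
    using inc by (auto simp: incseq_def intro!: sum_mset_mono)
  show "(\<Sum>x\<in>#X. SUP i. U i x) = (SUP i. \<Sum>x\<in>#X. U i x)"
    by (induction X) (simp_all add: ennreal_SUP_add inc *)
qed

text \<open>
  The sigma-algebra on configurations provides the measurability of the counts, which are the case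
  of indicator functions. The general case follows by linearity and monotone limits.
\<close>

lemma borel_measurable_sum_mset_config:
  fixes f :: "'a::topological_space \<Rightarrow> ennreal"
  assumes S: "S \<in> sets borel" and f: "f \<in> borel_measurable borel"
  shows "(\<lambda>X. \<Sum>x\<in>#X. f x) \<in> borel_measurable (config_space S)"
  using f
proof (induction rule: borel_measurable_induct)
  case (cong f g)
  then have "f = g" by (auto simp: fun_eq_iff)
  with cong show ?case by simp
next
  case (set A)
  have sp: "space (config_space S) = {X. set_mset X \<subseteq> S}"
    by (auto simp: config_space_def space_measure_of_conv)
  have "point_process (config_space S) S (\<lambda>X. X)"
    by (simp add: point_process_def)
  then have "(\<lambda>X. size {#x \<in># X. x \<in> A \<inter> S#}) \<in> config_space S \<rightarrow>\<^sub>M count_space UNIV"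
    using set S by (auto simp: point_process_iff)
  then have "(\<lambda>X. of_nat (size {#x \<in># X. x \<in> A \<inter> S#}) :: ennreal) \<in> borel_measurable (config_space S)"
    by (rule measurable_compose) simp
  moreover have "(\<Sum>x\<in>#X. indicator A x) = (of_nat (size {#x \<in># X. x \<in> A \<inter> S#}) :: ennreal)"
    if "set_mset X \<subseteq> S" for X
    using that by (induction X) (auto simp: indicator_def)
  ultimately show ?case
    by (subst measurable_cong) (auto simp: sp)
next
  case (mult u c)
  then show ?case by (simp flip: sum_mset_distrib_left)
next
  case (add u v)
  then show ?case by (simp add: sum_mset.distrib)
next
  case (seq U)
  then show ?case by (simp add: SUP_apply image_comp sum_mset_SUP)
qed

text \<open>
  Campbell's formula. For indicator functions it is the defining property of the intensity; the
  passage to general \<open>f\<close> is the usual one.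
\<close>

lemma campbell_nn_integral:
  fixes f :: "'a::euclidean_space \<Rightarrow> ennreal"
  assumes S: "S \<in> sets borel" and Z: "point_process M S Z" and \<kappa>: "has_intensity M S Z \<kappa>"
    and f: "f \<in> borel_measurable borel"
  shows "(\<integral>\<^sup>+w. (\<Sum>x\<in>#Z w. f x) \<partial>M) = (\<integral>\<^sup>+u\<in>S. f u * ennreal (\<kappa> u) \<partial>lborel)"
proof -
  define k where "k = (\<lambda>u. ennreal (\<kappa> u) * indicator S u)"
  have "(\<lambda>u. ennreal (indicator S u *\<^sub>R \<kappa> u)) \<in> borel_measurable borel"
    using \<kappa> by (auto simp: has_intensity_def set_borel_measurable_def)
  also have "(\<lambda>u. ennreal (indicator S u *\<^sub>R \<kappa> u)) = k"
    by (auto simp: k_def indicator_def)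
  finally have k [measurable]: "k \<in> borel_measurable borel" .
  have sub: "set_mset (Z w) \<subseteq> S" if "w \<in> space M" for w
    using Z that by (auto simp: point_process_iff)
  have meas: "(\<lambda>w. \<Sum>x\<in>#Z w. u x) \<in> borel_measurable M" if "u \<in> borel_measurable borel"
    for u :: "'a \<Rightarrow> ennreal"
    using Z borel_measurable_sum_mset_config[OF S that]
    unfolding point_process_def by (rule measurable_compose)
  have "(\<integral>\<^sup>+w. (\<Sum>x\<in>#Z w. f x) \<partial>M) = (\<integral>\<^sup>+u. f u * k u \<partial>lborel)"
    using f
  proof (induction rule: borel_measurable_induct)
    case (cong f g)
    then have "f = g" by (auto simp: fun_eq_iff)
    with cong show ?case by simp
  next
    case (set A)
    have "(\<integral>\<^sup>+w. (\<Sum>x\<in>#Z w. indicator A x) \<partial>M) = (\<integral>\<^sup>+w. (\<Sum>x\<in>#Z w. indicator (A \<inter> S) x) \<partial>M)"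
      using sub by (intro nn_integral_cong arg_cong[of _ _ sum_mset] image_mset_cong)
        (auto simp: indicator_def)
    also have "\<dots> = (\<integral>\<^sup>+u\<in>A \<inter> S. ennreal (\<kappa> u) \<partial>lborel)"
      using \<kappa> set S by (auto simp: has_intensity_def)
    also have "\<dots> = (\<integral>\<^sup>+u. indicator A u * k u \<partial>lborel)"
      by (intro nn_integral_cong) (auto simp: k_def indicator_def)
    finally show ?case .
  next
    case (mult u c)
    then show ?case
      by (simp add: nn_integral_cmult meas mult.assoc flip: sum_mset_distrib_left)
  next
    case (add u v)
    then show ?case
      by (simp add: nn_integral_add meas sum_mset.distrib distrib_right)
  next
    case (seq U)
    have inc: "incseq (\<lambda>i w. \<Sum>x\<in>#Z w. U i x)" "incseq (\<lambda>i u. U i u * k u)"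
      using sum_mset_SUP(2)[OF seq(3)] seq(3)
      by (auto simp: incseq_def le_fun_def intro!: mult_right_mono)
    have "(\<integral>\<^sup>+w. (\<Sum>x\<in>#Z w. SUP i. U i x) \<partial>M) = (SUP i. \<integral>\<^sup>+w. (\<Sum>x\<in>#Z w. U i x) \<partial>M)"
      unfolding sum_mset_SUP(1)[OF seq(3)]
      by (rule nn_integral_monotone_convergence_SUP[OF inc(1)]) (simp add: meas seq)
    also have "\<dots> = (SUP i. \<integral>\<^sup>+u. U i u * k u \<partial>lborel)"
      by (simp add: seq)
    also have "\<dots> = (\<integral>\<^sup>+u. (SUP i. U i u * k u) \<partial>lborel)"
      using seq(1) by (intro nn_integral_monotone_convergence_SUP[OF inc(2), symmetric]) simp
    finally show ?case
      by (simp add: SUP_apply image_comp SUP_mult_right_ennreal)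
  qed
  then show ?thesis by (simp add: k_def mult.assoc)
qed

lemma superpose_sum: "(\<Sum>x\<in>#superpose Z n w. f x) = (\<Sum>i<n. \<Sum>x\<in>#Z i w. f x)"
  by (induction n) (simp_all add: superpose_def)

text \<open>
  The strong law for the random sums of \<open>f\<close> over the points of each process, whose mean is given by
  Campbell's formula.
\<close>

lemma (in prob_space) point_process_sum_average:
  fixes f \<kappa> :: "'b::euclidean_space \<Rightarrow> real"
  assumes S: "S \<in> sets borel" and Z: "iid_point_processes M S Z"
    and \<kappa>: "has_intensity M S (Z 0) \<kappa>"
    and meas: "set_borel_measurable borel S f" and nonneg: "\<And>u. u \<in> S \<Longrightarrow> 0 \<le> f u"
    and int: "set_integrable lborel S (\<lambda>u. f u * \<kappa> u)"
  shows "AE w in M. (\<lambda>n. (\<Sum>x\<in>#superpose Z n w. f x) / n)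
    \<longlonglongrightarrow> (LINT u:S|lborel. f u * \<kappa> u)"
proof -
  \<comment> \<open>\<open>f\<close> is only controlled on \<open>S\<close>; its extension \<open>g\<close> by zero is measurable and nonnegative everywhere.\<close>
  define g where "g = (\<lambda>u. indicator S u * f u)"
  define \<Phi> where "\<Phi> = (\<lambda>X. \<Sum>x\<in>#X. g x)"
  have g [measurable]: "g \<in> borel_measurable borel" and g0: "0 \<le> g u" for u
    using meas nonneg by (auto simp: set_borel_measurable_def g_def indicator_def)
  have \<Phi>: "ennreal (\<Phi> X) = (\<Sum>x\<in>#X. ennreal (g x))" and \<Phi>0: "0 \<le> \<Phi> X" for X
    using g0 by (induction X) (auto simp: \<Phi>_def)
  have "(\<lambda>X. enn2real (\<Sum>x\<in>#X. ennreal (g x))) \<in> borel_measurable (config_space S)"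
    by (intro borel_measurable_enn2real borel_measurable_sum_mset_config[OF S]) simp
  then have \<Phi>m: "\<Phi> \<in> borel_measurable (config_space S)"
    by (simp flip: \<Phi> add: \<Phi>0)
  have Zi: "Z i \<in> M \<rightarrow>\<^sub>M config_space S" for i
    using Z unfolding iid_point_processes_def point_process_def by blast
  have "(\<integral>\<^sup>+w. ennreal (\<Phi> (Z 0 w)) \<partial>M) = (\<integral>\<^sup>+u\<in>S. ennreal (g u) * ennreal (\<kappa> u) \<partial>lborel)"
    unfolding \<Phi> by (rule campbell_nn_integral[OF S _ \<kappa>]) (auto simp: point_process_def Zi)
  also have "\<dots> = (\<integral>\<^sup>+u. ennreal (indicator S u *\<^sub>R (f u * \<kappa> u)) \<partial>lborel)"
    using \<kappa> nonneg by (intro nn_integral_cong)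
      (auto simp: g_def indicator_def has_intensity_def ennreal_mult)
  also have "\<dots> = ennreal (LINT u:S|lborel. f u * \<kappa> u)"
    unfolding set_lebesgue_integral_def
    using int \<kappa> nonneg
    by (intro nn_integral_eq_integral) (auto simp: set_integrable_def has_intensity_def indicator_def)
  finally have nn: "(\<integral>\<^sup>+w. ennreal (\<Phi> (Z 0 w)) \<partial>M) = ennreal (LINT u:S|lborel. f u * \<kappa> u)" .
  have L0: "0 \<le> (LINT u:S|lborel. f u * \<kappa> u)"
    unfolding set_lebesgue_integral_def
    using \<kappa> nonneg by (intro Bochner_Integration.integral_nonneg) (auto simp: has_intensity_def indicator_def)
  have meas0: "(\<lambda>w. \<Phi> (Z 0 w)) \<in> borel_measurable M"
    by (rule measurable_compose[OF Zi \<Phi>m])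
  have int0: "integrable M (\<lambda>w. \<Phi> (Z 0 w))"
    by (rule integrableI_nn_integral_finite[OF meas0 _ nn]) (auto simp: \<Phi>0 L0)
  have exp0: "expectation (\<lambda>w. \<Phi> (Z 0 w)) = (LINT u:S|lborel. f u * \<kappa> u)"
    by (rule integral_eq_nn_integral[THEN trans]) (auto simp: meas0 \<Phi>0 nn L0)
  have avg: "AE w in M. (\<lambda>n. (\<Sum>i<n. \<Phi> (Z i w)) / n) \<longlonglongrightarrow> expectation (\<lambda>w. \<Phi> (Z 0 w))"
  proof (rule strong_law_of_large_numbers)
    show "indep_vars (\<lambda>_. borel) (\<lambda>i w. \<Phi> (Z i w)) UNIV"
      by (rule indep_vars_compose2[OF _ \<Phi>m]) (use Z in \<open>unfold iid_point_processes_def, blast\<close>)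
    have d: "distr M borel (\<lambda>w. \<Phi> (Z i w)) = distr (distr M (config_space S) (Z i)) borel \<Phi>" for i
      using Zi \<Phi>m by (simp add: distr_distr comp_def)
    have e: "distr M (config_space S) (Z i) = distr M (config_space S) (Z 0)" for i
      using Z unfolding iid_point_processes_def by blast
    show "distr M borel (\<lambda>w. \<Phi> (Z i w)) = distr M borel (\<lambda>w. \<Phi> (Z 0 w))" for i
      by (simp add: d e[of i])
  qed (rule int0)
  have *: "\<Phi> (Z i w) = (\<Sum>x\<in>#Z i w. f x)" if "w \<in> space M" for i w
    using measurable_space[OF Zi that, of i] unfolding \<Phi>_def
    by (intro arg_cong[of _ _ sum_mset] image_mset_cong)
      (auto simp: config_space_def space_measure_of_conv g_def indicator_def)
  from avg AE_space show ?thesis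
    unfolding superpose_sum exp0 by eventually_elim (simp add: *)
qed

section \<open>Minimisers of convex random functions\<close>

text \<open>
  The segment from \<open>\<theta>\<^sub>0\<close> to a point \<open>\<theta>'\<close> outside the ball crosses the sphere. There \<open>F\<close> is larger than
  at \<open>\<theta>\<^sub>0\<close>, but by convexity it is at most the larger one of the values at the two ends.
\<close>

lemma convex_argmin_in_ball:
  fixes F :: "'a::real_normed_vector \<Rightarrow> real"
  assumes conv: "convex_on UNIV F" and "0 < r"
    and sphere: "\<And>\<theta>. \<theta> \<in> sphere \<theta>\<^sub>0 r \<Longrightarrow> F \<theta>\<^sub>0 < F \<theta>"
    and le: "F \<theta>' \<le> F \<theta>\<^sub>0"
  shows "dist \<theta>\<^sub>0 \<theta>' < r"
proof (rule ccontr)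
  assume "\<not> dist \<theta>\<^sub>0 \<theta>' < r"
  define d t where "d = dist \<theta>\<^sub>0 \<theta>'" and "t = r / d"
  have d: "r \<le> d" using \<open>\<not> dist \<theta>\<^sub>0 \<theta>' < r\<close> by (simp add: d_def)
  have t: "0 \<le> t" "t \<le> 1" using d \<open>0 < r\<close> by (auto simp: t_def)
  define \<theta> where "\<theta> = (1 - t) *\<^sub>R \<theta>\<^sub>0 + t *\<^sub>R \<theta>'"
  have "\<theta>\<^sub>0 - \<theta> = t *\<^sub>R (\<theta>\<^sub>0 - \<theta>')" by (simp add: \<theta>_def algebra_simps)
  then have "dist \<theta>\<^sub>0 \<theta> = t * d" using t by (simp add: dist_norm d_def)
  then have "\<theta> \<in> sphere \<theta>\<^sub>0 r" using d \<open>0 < r\<close> by (simp add: t_def)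
  then have "F \<theta>\<^sub>0 < F \<theta>" by (rule sphere)
  also have "F \<theta> \<le> (1 - t) * F \<theta>\<^sub>0 + t * F \<theta>'"
    unfolding \<theta>_def using t by (intro convex_onD[OF conv]) auto
  also have "\<dots> \<le> (1 - t) * F \<theta>\<^sub>0 + t * F \<theta>\<^sub>0"
    using le t by (intro add_left_mono mult_left_mono) auto
  finally show False by (simp add: algebra_simps)
qed

text \<open>
  Uniformity from finitely many limits. The points of \<open>D\<close> are chosen before the functions \<open>F n\<close> are
  known, so for random \<open>F n\<close> only the finitely many null sets belonging to \<open>D\<close> have to be discarded.
  The Lipschitz constants \<open>C n\<close> may depend on \<open>n\<close> as long as they have a limit.
\<close>

lemma finite_net_separation:
  fixes L :: "'a::metric_space \<Rightarrow> real" and c :: real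
  assumes "compact K" and sep: "\<And>\<theta>. \<theta> \<in> K \<Longrightarrow> L\<^sub>0 < L \<theta>"
  obtains D where "finite D" "D \<subseteq> K"
    and "\<And>F C. (\<And>n \<theta> \<theta>'. \<bar>F n \<theta> - F n \<theta>'\<bar> \<le> C n * dist \<theta> \<theta>') \<Longrightarrow> C \<longlonglongrightarrow> c
      \<Longrightarrow> (\<lambda>n. F n \<theta>\<^sub>0) \<longlonglongrightarrow> L\<^sub>0 \<Longrightarrow> (\<And>\<theta>. \<theta> \<in> D \<Longrightarrow> (\<lambda>n. F n \<theta>) \<longlonglongrightarrow> L \<theta>)
      \<Longrightarrow> \<forall>\<^sub>F n in sequentially. \<forall>\<theta>\<in>K. F n \<theta>\<^sub>0 < F n \<theta>"
proof -
  \<comment> \<open>Within distance \<open>r \<theta>\<close> of \<open>\<theta>\<close> a function with Lipschitz constant \<open>\<bar>c\<bar> + 1\<close> varies by at most a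
    quarter of the gap. Another quarter is kept at the net point, so the order of the values survives.\<close>
  define r where "r = (\<lambda>\<theta>. (L \<theta> - L\<^sub>0) / (4 * (\<bar>c\<bar> + 1)))"
  have r: "0 < r \<theta>" if "\<theta> \<in> K" for \<theta> using sep[OF that] by (simp add: r_def)
  obtain D where D: "D \<subseteq> K" "finite D" "K \<subseteq> (\<Union>\<theta>\<in>D. ball \<theta> (r \<theta>))"
    using compactE_image[OF \<open>compact K\<close>, of K "\<lambda>\<theta>. ball \<theta> (r \<theta>)"] r by force
  show thesis
  proof (rule that[OF D(2,1)])
    fix F :: "nat \<Rightarrow> 'a \<Rightarrow> real" and C :: "nat \<Rightarrow> real"
    assume lip: "\<And>n \<theta> \<theta>'. \<bar>F n \<theta> - F n \<theta>'\<bar> \<le> C n * dist \<theta> \<theta>'" and C: "C \<longlonglongrightarrow> c"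
      and F0: "(\<lambda>n. F n \<theta>\<^sub>0) \<longlonglongrightarrow> L\<^sub>0" and F: "\<And>\<theta>. \<theta> \<in> D \<Longrightarrow> (\<lambda>n. F n \<theta>) \<longlonglongrightarrow> L \<theta>"
    have "\<forall>\<^sub>F n in sequentially. F n \<theta>\<^sub>0 + (L \<theta> - L\<^sub>0) / 4 < F n \<theta>" if "\<theta> \<in> D" for \<theta>
    proof -
      have "(\<lambda>n. F n \<theta> - F n \<theta>\<^sub>0) \<longlonglongrightarrow> L \<theta> - L\<^sub>0"
        by (intro tendsto_intros F0 F that)
      moreover have "(L \<theta> - L\<^sub>0) / 4 < L \<theta> - L\<^sub>0" using sep that D by force
      ultimately have "\<forall>\<^sub>F n in sequentially. (L \<theta> - L\<^sub>0) / 4 < F n \<theta> - F n \<theta>\<^sub>0"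
        by (rule order_tendstoD(1))
      then show ?thesis by eventually_elim linarith
    qed
    then have "\<forall>\<^sub>F n in sequentially. \<forall>\<theta>\<in>D. F n \<theta>\<^sub>0 + (L \<theta> - L\<^sub>0) / 4 < F n \<theta>"
      using D(2) by (simp add: eventually_ball_finite)
    moreover have "\<forall>\<^sub>F n in sequentially. C n < \<bar>c\<bar> + 1"
      using C by (rule order_tendstoD) auto
    ultimately show "\<forall>\<^sub>F n in sequentially. \<forall>\<theta>\<in>K. F n \<theta>\<^sub>0 < F n \<theta>"
    proof eventually_elim
      case (elim n)
      show ?case
      proof
        fix \<theta> assume "\<theta> \<in> K"
        then obtain \<eta> where \<eta>: "\<eta> \<in> D" "dist \<eta> \<theta> < r \<eta>" using D by force
        have "F n \<eta> - F n \<theta> \<le> C n * dist \<eta> \<theta>" using lip[of n \<eta> \<theta>] by simp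
        also have "\<dots> \<le> (\<bar>c\<bar> + 1) * r \<eta>"
          using elim(2) \<eta>(2) by (intro mult_mono) auto
        also have "\<dots> = (L \<eta> - L\<^sub>0) / 4" by (simp add: r_def field_simps)
        finally have "F n \<eta> - F n \<theta> \<le> (L \<eta> - L\<^sub>0) / 4" .
        moreover have "F n \<theta>\<^sub>0 + (L \<eta> - L\<^sub>0) / 4 < F n \<eta>" using elim(1) \<eta>(1) by blast
        ultimately show "F n \<theta>\<^sub>0 < F n \<theta>" by linarith
      qed
    qed
  qed
qed

section \<open>The logistic loss\<close>

definition softplus :: "real \<Rightarrow> real" where
  "softplus t = ln (1 + exp t)"

lemma softplus_nonneg: "0 \<le> softplus t"
  by (simp add: softplus_def)

lemma softplus_le_exp: "softplus t \<le> exp t"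
  by (simp add: softplus_def ln_add_one_self_le_self)

lemma softplus_measurable [measurable]: "softplus \<in> borel_measurable borel"
  unfolding softplus_def by measurable

lemma softplus_lipschitz: "\<bar>softplus s - softplus t\<bar> \<le> \<bar>s - t\<bar>"
proof -
  have "softplus s \<le> (s - t) + softplus t" if "t \<le> s" for s t
  proof -
    have "1 + exp s \<le> exp (s - t) * (1 + exp t)"
      using that by (simp add: distrib_left flip: exp_add)
    then have "softplus s \<le> ln (exp (s - t) * (1 + exp t))"
      unfolding softplus_def by (intro ln_mono) (auto intro!: add_pos_pos)
    also have "\<dots> = (s - t) + softplus t"
      unfolding softplus_def by (subst ln_mult_pos) (auto intro: add_pos_pos)
    finally show ?thesis .
  qed
  moreover have "softplus s \<le> softplus t" if "s \<le> t" for s t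
    using that unfolding softplus_def by (subst ln_le_cancel_iff) (auto intro: add_pos_pos)
  ultimately show ?thesis by (smt (verit))
qed

lemma convex_softplus: "convex_on UNIV softplus"
proof (rule f''_ge0_imp_convex)
  fix t :: real
  have p: "0 < 1 + exp t" by (rule add_pos_pos) auto
  show "DERIV softplus t :> exp t / (1 + exp t)"
    unfolding softplus_def using p by (auto intro!: derivative_eq_intros)
  show "DERIV (\<lambda>t. exp t / (1 + exp t)) t :> exp t / (1 + exp t)\<^sup>2"
    using p by (auto intro!: derivative_eq_intros simp: field_simps power2_eq_square)
  show "0 \<le> exp t / (1 + exp t)\<^sup>2" by simp
qed auto

lemma convex_sum_mset_softplus:
  "convex_on UNIV (\<lambda>\<theta>. \<Sum>x\<in>#X. softplus (\<alpha> x + \<theta> \<bullet> \<beta> x))"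
proof (induction X)
  case (add x X)
  have "convex_on UNIV (\<lambda>\<theta>. softplus (\<alpha> x + \<theta> \<bullet> \<beta> x))"
  proof (rule convex_onI)
    fix t :: real and \<theta> \<theta>' assume t: "0 < t" "t < 1"
    have "\<alpha> x + ((1 - t) *\<^sub>R \<theta> + t *\<^sub>R \<theta>') \<bullet> \<beta> x
      = (1 - t) *\<^sub>R (\<alpha> x + \<theta> \<bullet> \<beta> x) + t *\<^sub>R (\<alpha> x + \<theta>' \<bullet> \<beta> x)"
      by (simp add: inner_add_left algebra_simps)
    then show "softplus (\<alpha> x + ((1 - t) *\<^sub>R \<theta> + t *\<^sub>R \<theta>') \<bullet> \<beta> x)
      \<le> (1 - t) * softplus (\<alpha> x + \<theta> \<bullet> \<beta> x) + t * softplus (\<alpha> x + \<theta>' \<bullet> \<beta> x)"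
      using convex_onD[OF convex_softplus] t by simp
  qed auto
  then show ?case using add by (simp add: convex_on_add)
qed (simp add: convex_on_const)

lemma lipschitz_sum_mset_softplus:
  fixes K :: real
  assumes "\<And>x. x \<in># X \<Longrightarrow> norm (\<beta> x) \<le> K"
  shows "\<bar>(\<Sum>x\<in>#X. softplus (\<alpha> x + \<theta> \<bullet> \<beta> x)) - (\<Sum>x\<in>#X. softplus (\<alpha> x + \<theta>' \<bullet> \<beta> x))\<bar>
    \<le> size X * K * dist \<theta> \<theta>'"
  using assms
proof (induction X)
  case (add x X)
  have "\<bar>softplus (\<alpha> x + \<theta> \<bullet> \<beta> x) - softplus (\<alpha> x + \<theta>' \<bullet> \<beta> x)\<bar> \<le> \<bar>(\<theta> - \<theta>') \<bullet> \<beta> x\<bar>"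
    using softplus_lipschitz[of "\<alpha> x + \<theta> \<bullet> \<beta> x" "\<alpha> x + \<theta>' \<bullet> \<beta> x"] by (simp add: inner_diff_left)
  also have "\<dots> \<le> dist \<theta> \<theta>' * norm (\<beta> x)"
    unfolding dist_norm by (rule Cauchy_Schwarz_ineq2)
  also have "\<dots> \<le> K * dist \<theta> \<theta>'"
    using mult_right_mono[OF add.prems[of x], of "dist \<theta> \<theta>'"] by (simp add: mult.commute)
  finally have "\<bar>softplus (\<alpha> x + \<theta> \<bullet> \<beta> x) - softplus (\<alpha> x + \<theta>' \<bullet> \<beta> x)\<bar> \<le> K * dist \<theta> \<theta>'" .
  moreover have "\<bar>(\<Sum>x\<in>#X. softplus (\<alpha> x + \<theta> \<bullet> \<beta> x)) - (\<Sum>x\<in>#X. softplus (\<alpha> x + \<theta>' \<bullet> \<beta> x))\<bar>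
    \<le> size X * K * dist \<theta> \<theta>'"
    using add by simp
  ultimately show ?case by (simp add: algebra_simps)
qed simp

lemma softplus_ln_ratio:
  assumes "0 < a" "0 < r"
  shows "softplus (ln (r / a)) = ln (a + r) - ln a"
proof -
  have "softplus (ln (r / a)) = ln ((a + r) / a)"
    using assms by (simp add: softplus_def add_divide_distrib)
  then show ?thesis using assms by (simp add: ln_divide_pos)
qed

text \<open>
  Gibbs' inequality for a two-valued label: among all odds \<open>t / r\<close>, the mean loss for labels with weights
  \<open>a\<close> and \<open>r\<close> is smallest at the true odds \<open>a / r\<close>. The left side minus the right side is
  \<open>a * ln x + r * ln y\<close>, where \<open>x\<close> and \<open>y\<close> are the ratios of the two label probabilities under \<open>t\<close>
  to those under \<open>a\<close>. By \<open>ln x \<le> x - 1\<close>, with equality at \<open>x = 1\<close> alone, it is at most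
  \<open>a * (x - 1) + r * (y - 1) = 0\<close>.
\<close>

lemma logistic_cross_entropy_minimal:
  assumes "0 < a" "0 < r" "0 < t"
  shows "a * softplus (ln (r / a)) + r * softplus (ln (a / r))
      \<le> a * softplus (ln (r / t)) + r * softplus (ln (t / r))" (is "?A \<le> ?T")
    and "a * softplus (ln (r / a)) + r * softplus (ln (a / r))
      = a * softplus (ln (r / t)) + r * softplus (ln (t / r)) \<Longrightarrow> t = a" 
proof -
  let ?x = "t * (a + r) / (a * (t + r))" and ?y = "(a + r) / (t + r)"
  have pos: "0 < ?x" "0 < ?y" using assms by simp_all
  have eq: "a * (?x - 1) + r * (?y - 1) = 0"
    using assms by (simp add: divide_simps add_pos_pos) (simp add: algebra_simps)
  have "ln ?x = ln t + ln (a + r) - (ln a + ln (t + r))"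
    using assms by (subst ln_divide_pos) (auto simp: ln_mult_pos)
  moreover have "ln ?y = ln (a + r) - ln (t + r)"
    using assms by (subst ln_divide_pos) auto
  moreover have "softplus (ln (r / a)) = ln (a + r) - ln a" "softplus (ln (a / r)) = ln (a + r) - ln r"
    "softplus (ln (r / t)) = ln (t + r) - ln t" "softplus (ln (t / r)) = ln (t + r) - ln r"
    using assms by (simp_all only: softplus_ln_ratio add.commute[of r])
  ultimately have *: "?A - ?T = a * ln ?x + r * ln ?y"
    by (simp only:) (simp only: algebra_simps)
  have le: "a * ln ?x \<le> a * (?x - 1)" "r * ln ?y \<le> r * (?y - 1)"
    using assms pos by (auto intro!: mult_left_mono ln_le_minus_one)
  show "?A \<le> ?T" using * le eq by linarith
  assume "?A = ?T"
  then have "r * ln ?y = r * (?y - 1)" using * le eq by linarith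
  then have "ln ?y = ?y - 1" using assms by simp
  then have "?y = 1" using pos by (intro ln_eq_minus_one)
  then show "t = a" using assms by simp
qed

section \<open>Consistency of the logistic estimator\<close>

lemma set_integrable_bounded_mult:
  fixes f g :: "'a::euclidean_space \<Rightarrow> real"
  assumes "set_integrable lborel S g" and "set_borel_measurable borel S f"
    and "\<And>u. u \<in> S \<Longrightarrow> \<bar>f u\<bar> \<le> B"
  shows "set_integrable lborel S (\<lambda>u. f u * g u)"
proof -
  have "set_integrable lborel S (\<lambda>u. B * g u)" using assms(1) by simp
  then show ?thesis
  proof (rule set_integrable_bound)
    have "(\<lambda>u. (indicator S u *\<^sub>R f u) * (indicator S u *\<^sub>R g u)) \<in> borel_measurable lborel"
      using assms(1,2) by (auto simp: set_borel_measurable_def set_integrable_def)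
    also have "(\<lambda>u. (indicator S u *\<^sub>R f u) * (indicator S u *\<^sub>R g u)) = (\<lambda>u. indicator S u *\<^sub>R (f u * g u))"
      by (auto simp: indicator_def)
    finally show "set_borel_measurable lborel S (\<lambda>u. f u * g u)"
      by (simp add: set_borel_measurable_def)
    show "AE u in lborel. u \<in> S \<longrightarrow> norm (f u * g u) \<le> norm (B * g u)"
    proof (intro AE_I2 impI)
      fix u assume "u \<in> S"
      then have "\<bar>f u\<bar> \<le> \<bar>B\<bar>" using assms(3)[of u] by linarith
      then show "norm (f u * g u) \<le> norm (B * g u)" by (simp add: abs_mult mult_right_mono)
    qed
  qed
qed

text \<open>
  The data of the theorem in the form in which the proof uses them: a region of any Euclidean space,
  explicit bounds in place of suprema and infima, and identifiability at the true parameter.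
\<close>

locale logistic_sample = prob_space M
  for M :: "'w measure" +
  fixes S :: "'a::euclidean_space set" and Y E :: "nat \<Rightarrow> 'w \<Rightarrow> 'a multiset"
    and b \<rho> :: "'a \<Rightarrow> real" and z :: "'a \<Rightarrow> real^'m" and \<Theta> :: "(real^'m) set"
    and \<theta>\<^sub>0 :: "real^'m" and K :: real
  assumes S: "S \<in> sets borel"
    and Y: "iid_point_processes M S Y" and E: "iid_point_processes M S E"
    and Y_int: "has_intensity M S (Y 0) (loglinear b z \<theta>\<^sub>0)" and E_int: "has_intensity M S (E 0) \<rho>"
    and b_pos: "\<And>u. u \<in> S \<Longrightarrow> 0 < b u" and b_meas: "set_borel_measurable borel S b"
    and \<rho>_pos: "\<And>u. u \<in> S \<Longrightarrow> 0 < \<rho> u" and \<rho>_int: "set_integrable lborel S \<rho>"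
    and z_meas: "set_borel_measurable borel S z" and z_bound: "\<And>u. u \<in> S \<Longrightarrow> norm (z u) \<le> K"
    and ratio: "\<And>\<theta>. \<theta> \<in> \<Theta> \<Longrightarrow> \<exists>e>0. \<exists>e'. \<forall>u\<in>S. e \<le> \<rho> u / loglinear b z \<theta> u \<and> \<rho> u / loglinear b z \<theta> u \<le> e'"
    and \<theta>\<^sub>0: "\<theta>\<^sub>0 \<in> \<Theta>"
    and ident: "\<And>\<theta>. \<theta> \<in> \<Theta> \<Longrightarrow> (AE u in lborel. u \<in> S \<longrightarrow> loglinear b z \<theta> u = loglinear b z \<theta>\<^sub>0 u) \<Longrightarrow> \<theta> = \<theta>\<^sub>0"
begin

abbreviation lam :: "real^'m \<Rightarrow> 'a \<Rightarrow> real" where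
  "lam \<equiv> loglinear b z"

definition offset :: "'a \<Rightarrow> real" where
  "offset u = ln (\<rho> u / b u)"

text \<open>
  The losses are written with an affine argument in \<open>\<theta>\<close>, which makes convexity and the Lipschitz bound
  immediate and is meaningful for all \<open>\<theta>\<close>. On \<open>S\<close> the arguments are the log odds of being a dummy point
  and of being a data point, see \<open>log_odds\<close>.
\<close>

definition loss\<^sub>Y :: "real^'m \<Rightarrow> 'a \<Rightarrow> real" where
  "loss\<^sub>Y \<theta> u = softplus (offset u + \<theta> \<bullet> (- z u))"

definition loss\<^sub>E :: "real^'m \<Rightarrow> 'a \<Rightarrow> real" where
  "loss\<^sub>E \<theta> u = softplus (- offset u + \<theta> \<bullet> z u)"

definition loss :: "nat \<Rightarrow> 'w \<Rightarrow> real^'m \<Rightarrow> real" where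
  "loss n w \<theta> = (\<Sum>x\<in>#superpose Y n w. loss\<^sub>Y \<theta> x) + (\<Sum>x\<in>#superpose E n w. loss\<^sub>E \<theta> x)"

definition risk :: "real^'m \<Rightarrow> real" where
  "risk \<theta> = (LINT u:S|lborel. loss\<^sub>Y \<theta> u * lam \<theta>\<^sub>0 u) + (LINT u:S|lborel. loss\<^sub>E \<theta> u * \<rho> u)"

lemma lam_pos: "u \<in> S \<Longrightarrow> 0 < lam \<theta> u"
  by (simp add: loglinear_def b_pos)

lemma log_odds:
  assumes "u \<in> S"
  shows "offset u + \<theta> \<bullet> (- z u) = ln (\<rho> u / lam \<theta> u)" and "- offset u + \<theta> \<bullet> z u = ln (lam \<theta> u / \<rho> u)"
  using assms b_pos \<rho>_pos by (simp_all add: offset_def loglinear_def ln_divide_pos ln_mult_pos)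

lemma loss_eq:
  assumes "u \<in> S"
  shows "loss\<^sub>Y \<theta> u = softplus (ln (\<rho> u / lam \<theta> u))" and "loss\<^sub>E \<theta> u = softplus (ln (lam \<theta> u / \<rho> u))"
  unfolding loss\<^sub>Y_def loss\<^sub>E_def log_odds[OF assms] by simp_all

lemma superpose_subset:
  assumes "w \<in> space M"
  shows "set_mset (superpose Y n w) \<subseteq> S" "set_mset (superpose E n w) \<subseteq> S"
proof -
  have "set_mset (superpose Z n w) \<subseteq> S" if "iid_point_processes M S Z" for Z
  proof -
    have "set_mset (Z i w) \<subseteq> S" for i
      using that assms unfolding iid_point_processes_def point_process_iff by blast
    then show ?thesis by (induction n) (auto simp: superpose_def)
  qed
  then show "set_mset (superpose Y n w) \<subseteq> S" "set_mset (superpose E n w) \<subseteq> S" using Y E by blast+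
qed

lemma loglik_eq_loss:
  assumes "w \<in> space M"
  shows "logistic_loglik lam \<rho> (superpose Y n w) (superpose E n w) \<theta> = - loss n w \<theta>"
proof -
  have *: "(\<Sum>x\<in>#X. f x) = - (\<Sum>x\<in>#X. g x)" if "set_mset X \<subseteq> S" "\<And>x. x \<in> S \<Longrightarrow> f x = - g x"
    for X and f g :: "'a \<Rightarrow> real"
    using that by (induction X) auto
  have "ln (lam \<theta> u / (lam \<theta> u + \<rho> u)) = - loss\<^sub>Y \<theta> u" 
    "ln (\<rho> u / (lam \<theta> u + \<rho> u)) = - loss\<^sub>E \<theta> u" if "u \<in> S" for u
    using lam_pos[OF that, of \<theta>] \<rho>_pos[OF that]
      softplus_ln_ratio[of "lam \<theta> u" "\<rho> u"] softplus_ln_ratio[of "\<rho> u" "lam \<theta> u"]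
    unfolding loss_eq[OF that] by (simp_all add: ln_divide_pos add_pos_pos add.commute)
  then show ?thesis
    unfolding logistic_loglik_def loss_def
    using superpose_subset[OF assms] by (simp add: *[of _ _ "loss\<^sub>Y \<theta>"] *[of _ _ "loss\<^sub>E \<theta>"])
qed

lemma convex_loss: "convex_on UNIV (loss n w)"
  unfolding loss_def loss\<^sub>Y_def loss\<^sub>E_def
  by (intro convex_on_add convex_sum_mset_softplus)

lemma lipschitz_loss:
  assumes "w \<in> space M"
  shows "\<bar>loss n w \<theta> - loss n w \<theta>'\<bar>
    \<le> (real (size (superpose Y n w)) + real (size (superpose E n w))) * K * dist \<theta> \<theta>'"
proof -
  have "\<bar>(\<Sum>x\<in>#superpose Y n w. loss\<^sub>Y \<theta> x) - (\<Sum>x\<in>#superpose Y n w. loss\<^sub>Y \<theta>' x)\<bar>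
      \<le> size (superpose Y n w) * K * dist \<theta> \<theta>'"
    "\<bar>(\<Sum>x\<in>#superpose E n w. loss\<^sub>E \<theta> x) - (\<Sum>x\<in>#superpose E n w. loss\<^sub>E \<theta>' x)\<bar>
      \<le> size (superpose E n w) * K * dist \<theta> \<theta>'"
    unfolding loss\<^sub>Y_def loss\<^sub>E_def
    by (rule lipschitz_sum_mset_softplus; use superpose_subset[OF assms] z_bound in force)+
  then show ?thesis unfolding loss_def by (simp add: algebra_simps)
qed

lemma indicator_measurable [measurable]: "(indicator S :: 'a \<Rightarrow> real) \<in> borel_measurable borel"
  using S by simp

lemma loss_measurable:
  "set_borel_measurable borel S (loss\<^sub>Y \<theta>)" "set_borel_measurable borel S (loss\<^sub>E \<theta>)"
proof -
  have [measurable]: "(\<lambda>u. indicator S u *\<^sub>R b u) \<in> borel_measurable borel"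
    "(\<lambda>u. indicator S u *\<^sub>R \<rho> u) \<in> borel_measurable borel"
    "(\<lambda>u. indicator S u *\<^sub>R z u) \<in> borel_measurable borel"
    using b_meas \<rho>_int z_meas by (auto simp: set_borel_measurable_def set_integrable_def dest: borel_measurable_integrable)
  let ?c = "\<lambda>u. ln ((indicator S u *\<^sub>R \<rho> u) / (indicator S u *\<^sub>R b u))"
  have "(\<lambda>u. indicator S u *\<^sub>R softplus (?c u + \<theta> \<bullet> (- (indicator S u *\<^sub>R z u)))) \<in> borel_measurable borel"
    "(\<lambda>u. indicator S u *\<^sub>R softplus (- ?c u + \<theta> \<bullet> (indicator S u *\<^sub>R z u))) \<in> borel_measurable borel"
    by measurable
  moreover have "(\<lambda>u. indicator S u *\<^sub>R softplus (?c u + \<theta> \<bullet> (- (indicator S u *\<^sub>R z u)))) = (\<lambda>u. indicator S u *\<^sub>R loss\<^sub>Y \<theta> u)"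
    "(\<lambda>u. indicator S u *\<^sub>R softplus (- ?c u + \<theta> \<bullet> (indicator S u *\<^sub>R z u))) = (\<lambda>u. indicator S u *\<^sub>R loss\<^sub>E \<theta> u)"
    by (auto simp: fun_eq_iff indicator_def loss\<^sub>Y_def loss\<^sub>E_def offset_def)
  ultimately show "set_borel_measurable borel S (loss\<^sub>Y \<theta>)" "set_borel_measurable borel S (loss\<^sub>E \<theta>)"
    by (simp_all add: set_borel_measurable_def)
qed

lemma lam_measurable: "set_borel_measurable borel S (lam \<theta>)"
proof -
  have [measurable]: "(\<lambda>u. indicator S u *\<^sub>R b u) \<in> borel_measurable borel"
    "(\<lambda>u. indicator S u *\<^sub>R z u) \<in> borel_measurable borel"
    using b_meas z_meas by (auto simp: set_borel_measurable_def)
  have "(\<lambda>u. (indicator S u *\<^sub>R b u) * exp (\<theta> \<bullet> (indicator S u *\<^sub>R z u))) \<in> borel_measurable borel"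
    by measurable
  also have "(\<lambda>u. (indicator S u *\<^sub>R b u) * exp (\<theta> \<bullet> (indicator S u *\<^sub>R z u))) = (\<lambda>u. indicator S u *\<^sub>R lam \<theta> u)"
    by (auto simp: fun_eq_iff indicator_def loglinear_def)
  finally show ?thesis by (simp add: set_borel_measurable_def)
qed

lemma lam_integrable: "set_integrable lborel S (lam \<theta>\<^sub>0)"
proof -
  obtain e where e: "0 < e" "\<And>u. u \<in> S \<Longrightarrow> e \<le> \<rho> u / lam \<theta>\<^sub>0 u"
    using ratio[OF \<theta>\<^sub>0] by blast
  have "set_integrable lborel S (\<lambda>u. \<rho> u / e)" using \<rho>_int e(1) by simp
  then show ?thesis
  proof (rule set_integrable_bound)
    show "set_borel_measurable lborel S (lam \<theta>\<^sub>0)"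
      using lam_measurable by (simp add: set_borel_measurable_def)
    have "lam \<theta>\<^sub>0 u \<le> \<rho> u / e" if "u \<in> S" for u
      using e(2)[OF that] e(1) lam_pos[OF that, of \<theta>\<^sub>0] by (simp add: field_simps)
    then show "AE u in lborel. u \<in> S \<longrightarrow> norm (lam \<theta>\<^sub>0 u) \<le> norm (\<rho> u / e)"
      using lam_pos \<rho>_pos e(1) by (intro AE_I2) (simp add: order_less_imp_le)
  qed
qed

text \<open>
  Since \<open>softplus t \<le> exp t\<close>, the losses are at most \<open>\<rho> / \<lambda>\<close> and \<open>\<lambda> / \<rho>\<close>, which are bounded on \<open>S\<close>.
\<close>

lemma losses_integrable:
  assumes "\<theta> \<in> \<Theta>"
  shows "set_integrable lborel S (\<lambda>u. loss\<^sub>Y \<theta> u * lam \<theta>\<^sub>0 u)"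
    and "set_integrable lborel S (\<lambda>u. loss\<^sub>E \<theta> u * \<rho> u)"
proof -
  obtain e e' where e: "0 < e" "\<And>u. u \<in> S \<Longrightarrow> e \<le> \<rho> u / lam \<theta> u" "\<And>u. u \<in> S \<Longrightarrow> \<rho> u / lam \<theta> u \<le> e'"
    using ratio[OF assms] by blast
  have "loss\<^sub>Y \<theta> u \<le> \<rho> u / lam \<theta> u" "loss\<^sub>E \<theta> u \<le> lam \<theta> u / \<rho> u" if "u \<in> S" for u
    using softplus_le_exp[of "ln (\<rho> u / lam \<theta> u)"] softplus_le_exp[of "ln (lam \<theta> u / \<rho> u)"]
      lam_pos[OF that, of \<theta>] \<rho>_pos[OF that] by (simp_all add: loss_eq[OF that])
  moreover have "lam \<theta> u / \<rho> u \<le> 1 / e" if "u \<in> S" for u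
    using e(1) e(2)[OF that] lam_pos[OF that, of \<theta>] \<rho>_pos[OF that] by (simp add: field_simps)
  ultimately have "\<bar>loss\<^sub>Y \<theta> u\<bar> \<le> e'" "\<bar>loss\<^sub>E \<theta> u\<bar> \<le> 1 / e" if "u \<in> S" for u
    using that e(3)[OF that] softplus_nonneg by (fastforce simp: loss\<^sub>Y_def loss\<^sub>E_def)+
  then show "set_integrable lborel S (\<lambda>u. loss\<^sub>Y \<theta> u * lam \<theta>\<^sub>0 u)"
    "set_integrable lborel S (\<lambda>u. loss\<^sub>E \<theta> u * \<rho> u)"
    using set_integrable_bounded_mult[OF lam_integrable loss_measurable(1)]
      set_integrable_bounded_mult[OF \<rho>_int loss_measurable(2)] by blast+
qed

lemma loss_average_tendsto_risk:
  assumes "\<theta> \<in> \<Theta>"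
  shows "AE w in M. (\<lambda>n. loss n w \<theta> / n) \<longlonglongrightarrow> risk \<theta>"
proof -
  have "AE w in M. (\<lambda>n. (\<Sum>x\<in>#superpose Y n w. loss\<^sub>Y \<theta> x) / n)
      \<longlonglongrightarrow> (LINT u:S|lborel. loss\<^sub>Y \<theta> u * lam \<theta>\<^sub>0 u)"
    by (rule point_process_sum_average[OF S Y Y_int loss_measurable(1) _ losses_integrable(1)[OF assms]])
      (simp add: loss\<^sub>Y_def softplus_nonneg)
  moreover have "AE w in M. (\<lambda>n. (\<Sum>x\<in>#superpose E n w. loss\<^sub>E \<theta> x) / n)
      \<longlonglongrightarrow> (LINT u:S|lborel. loss\<^sub>E \<theta> u * \<rho> u)"
    by (rule point_process_sum_average[OF S E E_int loss_measurable(2) _ losses_integrable(2)[OF assms]])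
      (simp add: loss\<^sub>E_def softplus_nonneg)
  ultimately show ?thesis
    by eventually_elim (simp add: loss_def risk_def add_divide_distrib tendsto_add)
qed

definition mean_points :: real where
  "mean_points = (LINT u:S|lborel. lam \<theta>\<^sub>0 u) + (LINT u:S|lborel. \<rho> u)"

text \<open>
  Times the bound on \<open>z\<close>, this is the Lipschitz constant of the averaged loss.
\<close>

lemma points_average_tendsto:
  "AE w in M. (\<lambda>n. (real (size (superpose Y n w)) + real (size (superpose E n w))) / n)
    \<longlonglongrightarrow> mean_points"
proof -
  have one: "set_borel_measurable borel S (\<lambda>_. 1 :: real)"
    by (simp add: set_borel_measurable_def)
  have "AE w in M. (\<lambda>n. (\<Sum>x\<in>#superpose Y n w. 1) / n) \<longlonglongrightarrow> (LINT u:S|lborel. 1 * lam \<theta>\<^sub>0 u)"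
    by (rule point_process_sum_average[OF S Y Y_int one]) (simp_all add: lam_integrable)
  moreover have "AE w in M. (\<lambda>n. (\<Sum>x\<in>#superpose E n w. 1) / n) \<longlonglongrightarrow> (LINT u:S|lborel. 1 * \<rho> u)"
    by (rule point_process_sum_average[OF S E E_int one]) (simp_all add: \<rho>_int)
  ultimately show ?thesis
    by eventually_elim (simp add: mean_points_def add_divide_distrib tendsto_add)
qed

text \<open>
  The difference of the risks is the integral of the nonnegative gap in Gibbs' inequality. If it were
  zero, the gap would vanish almost everywhere, so the two intensities would agree almost everywhere,
  against identifiability.
\<close>

lemma risk_less:
  assumes \<theta>: "\<theta> \<in> \<Theta>" and "\<theta> \<noteq> \<theta>\<^sub>0"
  shows "risk \<theta>\<^sub>0 < risk \<theta>"
proof -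
  define g where "g = (\<lambda>\<theta> u. loss\<^sub>Y \<theta> u * lam \<theta>\<^sub>0 u + loss\<^sub>E \<theta> u * \<rho> u)"
  have g_int: "set_integrable lborel S (g \<theta>)" and g_risk: "risk \<theta> = (LINT u:S|lborel. g \<theta> u)"
    if "\<theta> \<in> \<Theta>" for \<theta>
    using losses_integrable[OF that] by (auto simp: g_def risk_def)
  have le: "g \<theta>\<^sub>0 u \<le> g \<theta> u" and eq: "g \<theta>\<^sub>0 u = g \<theta> u \<Longrightarrow> lam \<theta> u = lam \<theta>\<^sub>0 u"
    if "u \<in> S" for u
    using logistic_cross_entropy_minimal[of "lam \<theta>\<^sub>0 u" "\<rho> u" "lam \<theta> u"]
      lam_pos[OF that] \<rho>_pos[OF that]
    unfolding g_def loss_eq[OF that] by (simp_all only: mult.commute)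
  let ?h = "\<lambda>u. indicator S u *\<^sub>R (g \<theta> u - g \<theta>\<^sub>0 u)"
  have int: "integrable lborel ?h"
    using set_integral_diff(1)[OF g_int[OF \<theta>] g_int[OF \<theta>\<^sub>0]] by (simp add: set_integrable_def)
  have diff: "risk \<theta> - risk \<theta>\<^sub>0 = integral\<^sup>L lborel ?h"
    using set_integral_diff(2)[OF g_int[OF \<theta>] g_int[OF \<theta>\<^sub>0]]
    by (simp add: g_risk \<theta> \<theta>\<^sub>0 set_lebesgue_integral_def)
  have nonneg: "AE u in lborel. 0 \<le> ?h u" using le by (intro AE_I2) (simp add: indicator_def)
  have "integral\<^sup>L lborel ?h \<noteq> 0"
  proof
    assume "integral\<^sup>L lborel ?h = 0"
    then have "AE u in lborel. ?h u = 0"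
      using integral_nonneg_eq_0_iff_AE[OF int nonneg] by simp
    then have "AE u in lborel. u \<in> S \<longrightarrow> lam \<theta> u = lam \<theta>\<^sub>0 u"
      by eventually_elim (auto intro: eq)
    with ident[OF \<theta>] \<open>\<theta> \<noteq> \<theta>\<^sub>0\<close> show False by simp
  qed
  moreover have "0 \<le> integral\<^sup>L lborel ?h" using nonneg by (rule integral_nonneg_AE)
  ultimately show ?thesis using diff by linarith
qed

lemma loss_separated_on_sphere:
  assumes "0 < r" "sphere \<theta>\<^sub>0 r \<subseteq> \<Theta>"
  shows "AE w in M. \<forall>\<^sub>F n in sequentially. \<forall>\<theta>\<in>sphere \<theta>\<^sub>0 r. loss n w \<theta>\<^sub>0 < loss n w \<theta>"
proof -
  have sep: "risk \<theta>\<^sub>0 < risk \<theta>" if "\<theta> \<in> sphere \<theta>\<^sub>0 r" for \<theta>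
    using assms that by (intro risk_less) auto
  show ?thesis
  proof (rule finite_net_separation[where L = risk and L\<^sub>0 = "risk \<theta>\<^sub>0" and c = "mean_points * K"
        and \<theta>\<^sub>0 = \<theta>\<^sub>0, OF compact_sphere sep])
    fix D assume D: "finite D" "D \<subseteq> sphere \<theta>\<^sub>0 r"
      and net: "\<And>F C. (\<And>n \<theta> \<theta>'. \<bar>F n \<theta> - F n \<theta>'\<bar> \<le> C n * dist \<theta> \<theta>')
        \<Longrightarrow> C \<longlonglongrightarrow> mean_points * K \<Longrightarrow> (\<lambda>n. F n \<theta>\<^sub>0) \<longlonglongrightarrow> risk \<theta>\<^sub>0
        \<Longrightarrow> (\<And>\<theta>. \<theta> \<in> D \<Longrightarrow> (\<lambda>n. F n \<theta>) \<longlonglongrightarrow> risk \<theta>)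
        \<Longrightarrow> \<forall>\<^sub>F n in sequentially. \<forall>\<theta>\<in>sphere \<theta>\<^sub>0 r. F n \<theta>\<^sub>0 < F n \<theta>"
    have "AE w in M. \<forall>\<theta>\<in>D. (\<lambda>n. loss n w \<theta> / n) \<longlonglongrightarrow> risk \<theta>"
      using D assms by (intro AE_finite_allI loss_average_tendsto_risk) auto
    with loss_average_tendsto_risk[OF \<theta>\<^sub>0] points_average_tendsto AE_space show ?thesis
    proof eventually_elim
      case (elim w)
      let ?C = "\<lambda>n. (real (size (superpose Y n w)) + real (size (superpose E n w))) / n * K"
      \<comment> \<open>The strict inequality excludes \<open>n = 0\<close>, where both quotients are zero, so that \<open>n\<close> can be cancelled.\<close>
      have "\<forall>\<^sub>F n in sequentially. \<forall>\<theta>\<in>sphere \<theta>\<^sub>0 r. loss n w \<theta>\<^sub>0 / n < loss n w \<theta> / n"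
      proof (rule net)
        show "?C \<longlonglongrightarrow> mean_points * K" using elim by (intro tendsto_mult_right)
        show "\<bar>loss n w \<theta> / n - loss n w \<theta>' / n\<bar> \<le> ?C n * dist \<theta> \<theta>'" for n \<theta> \<theta>'
          using divide_right_mono[OF lipschitz_loss[OF elim(3), of n \<theta> \<theta>'], of "real n"]
          by (simp add: diff_divide_distrib[symmetric] mult_ac)
      qed (use elim in auto)
      then show ?case
        by eventually_elim (auto simp: divide_less_cancel)
    qed
  qed
qed

text \<open>
  Countably many spheres with radii tending to \<open>0\<close> suffice, and almost surely the loss at \<open>\<theta>\<^sub>0\<close> is
  eventually separated from the loss on each of them.
\<close>

theorem argmax_consistent:
  assumes "open \<Theta>"
  shows "AE w in M. (\<forall>\<^sub>F n in sequentially.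
      is_arg_max (logistic_loglik lam \<rho> (superpose Y n w) (superpose E n w)) (\<lambda>\<theta>. \<theta> \<in> \<Theta>) (\<theta>hat n w))
    \<longrightarrow> (\<lambda>n. \<theta>hat n w) \<longlonglongrightarrow> \<theta>\<^sub>0"
proof -
  obtain R where R: "0 < R" "cball \<theta>\<^sub>0 R \<subseteq> \<Theta>"
    using assms \<theta>\<^sub>0 open_contains_cball by blast
  define r where "r = (\<lambda>k::nat. R / Suc k)"
  have r: "0 < r k" "r k \<le> R" for k
    using R(1) by (auto simp: r_def field_simps)
  have "AE w in M. \<forall>k. \<forall>\<^sub>F n in sequentially. \<forall>\<theta>\<in>sphere \<theta>\<^sub>0 (r k). loss n w \<theta>\<^sub>0 < loss n w \<theta>"
  proof (subst AE_all_countable, intro allI loss_separated_on_sphere)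
    fix k
    show "0 < r k" "sphere \<theta>\<^sub>0 (r k) \<subseteq> \<Theta>"
      using r[of k] R(2) by (auto simp: subset_iff)
  qed
  with AE_space show ?thesis
  proof eventually_elim
    case (elim w)
    show ?case
    proof
      assume max: "\<forall>\<^sub>F n in sequentially.
        is_arg_max (logistic_loglik lam \<rho> (superpose Y n w) (superpose E n w)) (\<lambda>\<theta>. \<theta> \<in> \<Theta>) (\<theta>hat n w)"
      show "(\<lambda>n. \<theta>hat n w) \<longlonglongrightarrow> \<theta>\<^sub>0"
      proof (rule tendstoI)
        fix e :: real assume "0 < e"
        then obtain k where "1 / real (Suc k) < e / R" using nat_approx_posE[of "e / R"] R(1) by auto
        then have k: "r k < e" using R(1) by (simp add: r_def field_simps)
        from max elim(2)[rule_format, of k] show "\<forall>\<^sub>F n in sequentially. dist (\<theta>hat n w) \<theta>\<^sub>0 < e"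
        proof eventually_elim
          case (elim n)
          have "loss n w (\<theta>hat n w) \<le> loss n w \<theta>\<^sub>0"
            using elim(1) \<theta>\<^sub>0 by (auto simp: is_arg_max_def loglik_eq_loss[OF \<open>w \<in> space M\<close>] not_less)
          then have "dist \<theta>\<^sub>0 (\<theta>hat n w) < r k"
            using elim(2) r by (intro convex_argmin_in_ball[OF convex_loss, of "r k"]) auto
          with k show ?case by (simp add: dist_commute)
        qed
      qed
    qed
  qed
qed

end

theorem theorem4p1:
  fixes M :: "'w measure"
    and W :: "(real^2) set" and T :: "real set"
    and Y E :: "nat \<Rightarrow> 'w \<Rightarrow> ((real^2) \<times> real) multiset"
    and b \<rho> :: "(real^2) \<times> real \<Rightarrow> real"
    and z :: "(real^2) \<times> real \<Rightarrow> real^'m"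
    and \<Theta> :: "(real^'m) set" and \<theta>\<^sub>0 :: "real^'m"
    and \<theta>hat :: "nat \<Rightarrow> 'w \<Rightarrow> real^'m"
  defines "S \<equiv> W \<times> T"
    and "lam \<equiv> loglinear b z"
    and "l \<equiv> (\<lambda>n w. logistic_loglik (loglinear b z) \<rho> (superpose Y n w) (superpose E n w))"
  assumes "prob_space M"
    and "bounded S" and "S \<noteq> {}" and "open S"
    and "iid_point_processes M S Y" and "iid_point_processes M S E"
    and "indep_sequences M S Y E"
    and "\<forall>u\<in>S. 0 < b u" and "set_integrable lborel S b"
    and "set_borel_measurable borel S z"
    and "open \<Theta>"
    and "\<forall>u\<in>S. 0 < \<rho> u" and "set_integrable lborel S \<rho>"
    and "\<forall>i. has_intensity M S (E i) \<rho>"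
    and "\<forall>\<theta>\<in>\<Theta>. \<exists>\<epsilon>\<^sub>1>0. \<exists>\<epsilon>\<^sub>2>0.
           ereal \<epsilon>\<^sub>1 < (INF u\<in>S. ereal (\<rho> u / lam \<theta> u)) \<and>
           (SUP u\<in>S. ereal (\<rho> u / lam \<theta> u)) < ereal \<epsilon>\<^sub>2"
    and "(SUP u\<in>S. ereal (norm (z u))) < \<infinity>"
    and "convex \<Theta>"
    and "\<forall>\<theta>\<in>\<Theta>. \<forall>\<theta>'\<in>\<Theta>.
           (AE u in lborel. u \<in> S \<longrightarrow> lam \<theta> u = lam \<theta>' u) \<longrightarrow> \<theta> = \<theta>'"
    and "\<theta>\<^sub>0 \<in> \<Theta>"
    and "\<forall>i. has_intensity M S (Y i) (lam \<theta>\<^sub>0)"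
  shows "AE w in M.
           (\<forall>\<^sub>F n in sequentially. is_arg_max (l n w) (\<lambda>\<theta>. \<theta> \<in> \<Theta>) (\<theta>hat n w)) \<longrightarrow>
           (\<lambda>n. \<theta>hat n w) \<longlonglongrightarrow> \<theta>\<^sub>0"
proof -
  obtain K :: nat where "(SUP u\<in>S. ereal (norm (z u))) < ereal (real K)"
    using \<open>(SUP u\<in>S. ereal (norm (z u))) < \<infinity>\<close> less_PInf_Ex_of_nat by auto
  then have K: "norm (z u) \<le> real K" if "u \<in> S" for u
    using SUP_lessD[OF _ that] by force
  have ratio: "\<exists>e>0. \<exists>e'. \<forall>u\<in>S. e \<le> \<rho> u / lam \<theta> u \<and> \<rho> u / lam \<theta> u \<le> e'" if \<theta>: "\<theta> \<in> \<Theta>" for \<theta>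
  proof -
    obtain e e' where e: "0 < e" "ereal e < (INF u\<in>S. ereal (\<rho> u / lam \<theta> u))"
      "(SUP u\<in>S. ereal (\<rho> u / lam \<theta> u)) < ereal e'"
      using assms(18) \<theta> by blast
    have "e \<le> \<rho> u / lam \<theta> u \<and> \<rho> u / lam \<theta> u \<le> e'" if "u \<in> S" for u
      using less_INF_D[OF e(2) that] SUP_lessD[OF e(3) that] by simp
    with e(1) show ?thesis by blast
  qed
  interpret logistic_sample M S Y E b \<rho> z \<Theta> \<theta>\<^sub>0 K
  proof (intro logistic_sample.intro logistic_sample_axioms.intro)
    show "S \<in> sets borel" using \<open>open S\<close> by simp
    show "set_borel_measurable borel S b"
      using \<open>set_integrable lborel S b\<close>
      by (auto simp: set_borel_measurable_def set_integrable_def dest: borel_measurable_integrable)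
    show "has_intensity M S (Y 0) (loglinear b z \<theta>\<^sub>0)"
      using \<open>\<forall>i. has_intensity M S (Y i) (lam \<theta>\<^sub>0)\<close> by (simp add: lam_def)
    show "\<exists>e>0. \<exists>e'. \<forall>u\<in>S. e \<le> \<rho> u / loglinear b z \<theta> u \<and> \<rho> u / loglinear b z \<theta> u \<le> e'"
      if "\<theta> \<in> \<Theta>" for \<theta>
      using ratio[OF that] by (simp add: lam_def)
    show "\<theta> = \<theta>\<^sub>0" if "\<theta> \<in> \<Theta>" "AE u in lborel. u \<in> S \<longrightarrow> loglinear b z \<theta> u = loglinear b z \<theta>\<^sub>0 u"
      for \<theta>
      using assms(21) \<open>\<theta>\<^sub>0 \<in> \<Theta>\<close> that unfolding lam_def by blast
  qed (use \<open>prob_space M\<close> \<open>iid_point_processes M S Y\<close> \<open>iid_point_processes M S E\<close>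
      \<open>\<forall>u\<in>S. 0 < b u\<close> \<open>\<forall>u\<in>S. 0 < \<rho> u\<close> \<open>set_integrable lborel S \<rho>\<close>
      \<open>set_borel_measurable borel S z\<close> \<open>\<forall>i. has_intensity M S (E i) \<rho>\<close> \<open>\<theta>\<^sub>0 \<in> \<Theta>\<close> K in blast)+
  show ?thesis
    unfolding l_def by (rule argmax_consistent) fact
qed

end
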